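(* For every positive integer $n$, the minimum order of a simple connected $(4n+1)$-regular graph having \textbf{rna} number one is $8n+6$.
   Context: All graphs are simple, connected and undirected. For a graph $G$ of order $N$, the \textbf{rna} number $\sigma^{-}(G)$ is the minimum, over all bijections $f: V(G)\to\{1,2,\dots,N\}$, of the number of edges $uv$ of $G$ such that $f(u)$ and $f(v)$ have different parity. *)

theory Defs
  imports "Graph_Theory.Graph_Theory"
begin

text \<open>Finite simple undirected graphs are represented by \<^locale>\<open>pair_graph\<close>: finite loop-free
  symmetric digraphs whose arcs are ordered pairs of vertices.  Each undirected edge \<open>uv\<close> occurs as the
  two arcs \<open>(u, v)\<close> and \<open>(v, u)\<close>, so edges are counted as the unordered pairs \<open>{u, v}\<close>, and the degree
  of a vertex is its out-degree.\<close>

definition regular_graph :: "nat \<Rightarrow> 'a pair_pre_digraph \<Rightarrow> bool" where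
  "regular_graph k G \<longleftrightarrow> (\<forall>v \<in> pverts G. out_degree (with_proj G) v = k)"

definition odd_even_edges :: "'a pair_pre_digraph \<Rightarrow> ('a \<Rightarrow> nat) \<Rightarrow> 'a set set" where
  "odd_even_edges G f = {{u, v} | u v. (u, v) \<in> parcs G \<and> (even (f u) \<noteq> even (f v))}"

definition rna_number :: "'a pair_pre_digraph \<Rightarrow> nat" where
  "rna_number G =
     (LEAST k. \<exists>f. bij_betw f (pverts G) {1..card (pverts G)} \<and> k = card (odd_even_edges G f))"

end

theory Submission
  imports Defs
begin

text \<open>A labelling with exactly one odd-even edge splits the vertices into two sides joined by a
  single edge.  Counting arcs that start in one side, an even number of them stay inside and one
  leaves, so for odd degree \<open>k\<close> each side has odd order.  A side contains a vertex that is not an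
  end of the joining edge, together with its \<open>k\<close> neighbours, so its order is at least \<open>k + 1\<close>,
  hence at least \<open>k + 2\<close> by parity.

  Equality is attained by joining two copies of the graph on \<open>k + 2\<close> vertices whose complement
  is a path on three vertices plus a perfect matching of the rest; the joining edge connects the
  centres of the two paths.\<close>

lemma even_card_sym_irrefl:
  assumes "finite R" "sym R" "irrefl R"
  shows "even (card R)"
  using assms
proof (induction R rule: finite_psubset_induct)
  case (psubset R)
  show ?case
  proof (cases "R = {}")
    case False
    then obtain a b where ab: "(a, b) \<in> R" by auto
    have ba: "(b, a) \<in> R" and ne: "a \<noteq> b"
      using ab psubset.prems by (auto dest: symD simp: irrefl_def)
    let ?S = "R - {(a, b), (b, a)}"
    have "even (card ?S)"
    proof (rule psubset.IH)
      show "?S \<subset> R" using ab by auto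
      show "sym ?S" using psubset.prems by (auto simp: sym_def)
      show "irrefl ?S" using psubset.prems by (auto simp: irrefl_def)
    qed
    moreover have "card R = card ?S + 2"
      using card_Diff_subset[of "{(a, b), (b, a)}" R] card_mono[of R "{(a, b), (b, a)}"]
        ab ba ne psubset.hyps by auto
    ultimately show ?thesis by simp
  qed simp
qed

lemma card_side_of_bridge:
  fixes E :: "'a rel"
  assumes "finite E" "sym E" "irrefl E" "finite A" "odd k" "k \<ge> 2"
    and degree: "\<And>v. v \<in> A \<Longrightarrow> card (E `` {v}) = k"
    and cut: "E \<inter> A \<times> (- A) = {(a, b)}"
  shows "k + 2 \<le> card A"
proof -
  have fin: "finite (E `` {v})" for v
    using \<open>finite E\<close> by (rule finite_Image)
  have "even (card (E \<inter> A \<times> A))"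
    using assms(1-3) by (intro even_card_sym_irrefl) (auto simp: sym_def irrefl_def)
  moreover have "card A * k = card (E \<inter> A \<times> A) + 1"
  proof -
    have "card A * k = card (SIGMA v:A. E `` {v})"
      using \<open>finite A\<close> fin degree by (simp add: card_SigmaI)
    also have "(SIGMA v:A. E `` {v}) = (E \<inter> A \<times> A) \<union> (E \<inter> A \<times> (- A))"
      by auto
    also have "card \<dots> = card (E \<inter> A \<times> A) + card (E \<inter> A \<times> (- A))"
      using \<open>finite E\<close> by (intro card_Un_disjoint) auto
    finally show ?thesis by (simp add: cut)
  qed
  ultimately have "odd (card A * k)" by simp
  then have odd_card: "odd (card A)" by simp
  have ab: "a \<in> A" "(a, b) \<in> E" using cut by auto
  have "E `` {a} - {b} \<subseteq> A - {a}"
    using cut \<open>irrefl E\<close> ab by (auto simp: irrefl_def)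
  then have "card (E `` {a} - {b}) \<le> card (A - {a})"
    using \<open>finite A\<close> by (intro card_mono) auto
  then have "k \<le> card A"
    using ab degree[of a] \<open>finite A\<close> \<open>k \<ge> 2\<close> by (simp add: card_Diff_singleton)
  then have "A \<noteq> {a}" using \<open>k \<ge> 2\<close> by auto
  then obtain c where c: "c \<in> A" "c \<noteq> a" using ab by auto
  have "E `` {c} \<subseteq> A - {c}"
    using cut \<open>irrefl E\<close> c by (auto simp: irrefl_def)
  then have "card (E `` {c}) \<le> card (A - {c})"
    using \<open>finite A\<close> by (intro card_mono) auto
  moreover have "card A > 0" using c \<open>finite A\<close> by (auto simp: card_gt_0_iff)
  ultimately have "k + 1 \<le> card A"
    using c degree[of c] by (simp add: card_Diff_singleton)
  moreover have "card A \<noteq> k + 1" using odd_card \<open>odd k\<close> by auto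
  ultimately show ?thesis by simp
qed

lemma out_degree_with_proj: "out_degree (with_proj G) v = card (parcs G `` {v})"
proof -
  have "out_arcs (with_proj G) v = Pair v ` (parcs G `` {v})"
    by auto
  then show ?thesis
    unfolding out_degree_def by (simp add: card_image inj_on_def)
qed

lemma rna_number_attained:
  assumes "finite (pverts G)"
  obtains f where "bij_betw f (pverts G) {1..card (pverts G)}"
    "rna_number G = card (odd_even_edges G f)"
proof -
  obtain h where "bij_betw h (pverts G) {1..card (pverts G)}"
    using finite_same_card_bij[OF assms, of "{1..card (pverts G)}"] by auto
  then have "\<exists>k f. bij_betw f (pverts G) {1..card (pverts G)} \<and> k = card (odd_even_edges G f)"
    by blast
  then have "\<exists>f. bij_betw f (pverts G) {1..card (pverts G)}
      \<and> rna_number G = card (odd_even_edges G f)"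
    unfolding rna_number_def by (rule LeastI_ex)
  then show ?thesis using that by blast
qed

lemma rna_number_le:
  assumes "bij_betw f (pverts G) {1..card (pverts G)}"
  shows "rna_number G \<le> card (odd_even_edges G f)"
  unfolding rna_number_def using assms by (intro Least_le) blast

lemma (in pair_graph) odd_even_edges_nonempty:
  assumes "Digraph_Component.connected (with_proj G)" "card (pverts G) \<ge> 2"
    and f: "bij_betw f (pverts G) {1..card (pverts G)}"
  shows "odd_even_edges G f \<noteq> {}"
proof
  assume empty: "odd_even_edges G f = {}"
  have "1 \<in> f ` pverts G" "2 \<in> f ` pverts G"
    using f assms(2) by (auto simp: bij_betw_def)
  then obtain u v where uv: "u \<in> pverts G" "f u = 1" "v \<in> pverts G" "f v = 2"
    by (metis imageE)
  have "strongly_connected (with_proj G)"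
    using assms(1) pair_sym_arcs by (intro symmetric_connected_imp_strongly_connected)
  then have "u \<rightarrow>\<^sup>*\<^bsub>with_proj G\<^esub> v" using uv by auto
  then have "even (f v) = even (f u)"
  proof (induction rule: reachable_induct)
    case (step x y)
    then show ?case using empty by (auto simp: odd_even_edges_def)
  qed simp
  then show False using uv by simp
qed

lemma (in pair_graph) card_verts_rna_number_one:
  assumes reg: "regular_graph k G" and k: "odd k" "k \<ge> 2" and rna: "rna_number G = 1"
  shows "2 * (k + 2) \<le> card (pverts G)"
proof -
  obtain f where "card (odd_even_edges G f) = 1"
    using rna_number_attained[OF pair_finite_verts] rna by metis
  then obtain e where e: "odd_even_edges G f = {e}"
    by (auto simp: card_1_singleton_iff)
  then have "e \<in> odd_even_edges G f" by simp
  then obtain a' b' where a'b': "(a', b') \<in> parcs G" "even (f a') \<noteq> even (f b')" "e = {a', b'}"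
    by (auto simp: odd_even_edges_def)
  have sym: "sym (parcs G)" using pair_sym_arcs by (simp add: symmetric_def)
  have irrefl: "irrefl (parcs G)" using pair_no_loops by (force simp: irrefl_def)
  obtain a b where ab: "(a, b) \<in> parcs G" "odd (f a)" "even (f b)" "e = {a, b}"
    using a'b' sym by (cases "even (f a')") (auto dest: symD)
  let ?A = "{v \<in> pverts G. odd (f v)}" and ?B = "{v \<in> pverts G. even (f v)}"
  have uniq: "u = a \<and> v = b" if "(u, v) \<in> parcs G" "odd (f u)" "even (f v)" for u v
  proof -
    have "{u, v} \<in> odd_even_edges G f" using that by (auto simp: odd_even_edges_def)
    then have "{u, v} = {a, b}" using e ab by simp
    then show ?thesis using that ab by (auto simp: doubleton_eq_iff)
  qed
  have cutA: "parcs G \<inter> ?A \<times> (- ?A) = {(a, b)}"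
    using ab by (auto dest: uniq in_arcsD1 in_arcsD2)
  have ba: "(b, a) \<in> parcs G" using sym ab by (auto dest: symD)
  have uniq': "u = b \<and> v = a" if "(u, v) \<in> parcs G" "even (f u)" "odd (f v)" for u v
    using uniq[of v u] that sym by (auto dest: symD)
  have cutB: "parcs G \<inter> ?B \<times> (- ?B) = {(b, a)}"
    using ab ba by (auto dest: uniq' in_arcsD1 in_arcsD2)
  have deg: "card (parcs G `` {v}) = k" if "v \<in> pverts G" for v
    using reg that by (simp add: regular_graph_def out_degree_with_proj)
  have "k + 2 \<le> card ?A"
    using pair_finite_arcs sym irrefl _ k _ cutA
    by (rule card_side_of_bridge) (use pair_finite_verts deg in auto)
  moreover have "k + 2 \<le> card ?B"
    using pair_finite_arcs sym irrefl _ k _ cutB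
    by (rule card_side_of_bridge) (use pair_finite_verts deg in auto)
  moreover have "card (pverts G) = card ?A + card ?B"
    using pair_finite_verts by (subst card_Un_disjoint[symmetric]) (auto intro: arg_cong[where f=card])
  ultimately show ?thesis by simp
qed

text \<open>One half of the extremal graph, on the vertices \<open>0, \<dots>, 4n + 2\<close>: the complement consists of
  the path \<open>0 - 1 - 2\<close> and the matching \<open>{3, 4}, {5, 6}, \<dots>\<close>.\<close>

definition half_adj :: "nat \<Rightarrow> nat \<Rightarrow> bool" where
  "half_adj i j \<longleftrightarrow> (i + 1) div 2 \<noteq> (j + 1) div 2 \<and> {i, j} \<noteq> {0, 1}"

text \<open>The two halves live on the even and on the odd numbers, so that \<open>Suc\<close> is an optimal
  labelling.\<close>

definition bridge_adj :: "nat \<Rightarrow> nat \<Rightarrow> bool" where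
  "bridge_adj x y \<longleftrightarrow> (even x = even y \<and> half_adj (x div 2) (y div 2)) \<or> {x, y} = {2, 3}"

definition bridge_graph :: "nat \<Rightarrow> nat pair_pre_digraph" where
  "bridge_graph n = \<lparr>pverts = {..<8 * n + 6},
     parcs = {(x, y). x < 8 * n + 6 \<and> y < 8 * n + 6 \<and> bridge_adj x y}\<rparr>"

lemma half_adj_sym: "half_adj i j \<longleftrightarrow> half_adj j i"
  unfolding half_adj_def by (metis insert_commute)

lemma bridge_adj_sym: "bridge_adj x y \<longleftrightarrow> bridge_adj y x"
  unfolding bridge_adj_def using half_adj_sym by (metis insert_commute)

lemma pair_graph_bridge_graph: "pair_graph (bridge_graph n)"
proof
  show "finite (parcs (bridge_graph n))"
    by (rule finite_subset[of _ "{..<8 * n + 6} \<times> {..<8 * n + 6}"]) (auto simp: bridge_graph_def)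
  show "symmetric (with_proj (bridge_graph n))"
    using bridge_adj_sym by (auto simp: symmetric_def sym_def bridge_graph_def)
  show "fst e \<noteq> snd e" if "e \<in> parcs (bridge_graph n)" for e
    using that by (auto simp: bridge_graph_def bridge_adj_def half_adj_def)
qed (auto simp: bridge_graph_def)

lemma card_half_neighbours:
  assumes "i < 4 * n + 3"
  shows "card {j. j < 4 * n + 3 \<and> half_adj i j} = (if i = 1 then 4 * n else 4 * n + 1)"
proof -
  let ?N = "{j. j < 4 * n + 3 \<and> \<not> half_adj i j}"
  have "{j. j < 4 * n + 3 \<and> half_adj i j} = {..<4 * n + 3} - ?N" by auto
  then have "card {j. j < 4 * n + 3 \<and> half_adj i j} = 4 * n + 3 - card ?N"
    by (simp add: card_Diff_subset subset_iff)
  moreover have "card ?N = (if i = 1 then 3 else 2)"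
  proof -
    have N: "j \<in> ?N \<longleftrightarrow> j < 4 * n + 3 \<and> ((i + 1) div 2 = (j + 1) div 2 \<or> i = 0 \<and> j = 1 \<or> i = 1 \<and> j = 0)"
      for j by (auto simp: half_adj_def doubleton_eq_iff)
    consider "i = 0" | "i = 1" | "i \<ge> 2" "odd i" | "i \<ge> 2" "even i"
      by linarith
    then show ?thesis
    proof cases
      case 1
      have "?N = {0, 1}" unfolding set_eq_iff N using 1 by (auto; presburger)
      then show ?thesis using 1 by simp
    next
      case 2
      have "?N = {0, 1, 2}" unfolding set_eq_iff N using 2 by (auto; presburger)
      then show ?thesis using 2 by simp
    next
      case 3
      have "?N = {i, i + 1}" unfolding set_eq_iff N using 3 assms by (auto; presburger)
      then show ?thesis using 3 by simp
    next
      case 4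
      have "?N = {i, i - 1}" unfolding set_eq_iff N using 4 assms by (auto; presburger)
      then show ?thesis using 4 by simp
    qed
  qed
  ultimately show ?thesis by simp
qed

lemma regular_bridge_graph: "regular_graph (4 * n + 1) (bridge_graph n)"
  unfolding regular_graph_def
proof
  fix x assume "x \<in> pverts (bridge_graph n)"
  then have x: "x < 8 * n + 6" by (simp add: bridge_graph_def)
  let ?H = "{j. j < 4 * n + 3 \<and> half_adj (x div 2) j}"
  let ?h = "\<lambda>j. 2 * j + x mod 2"
  let ?C = "if x = 2 then {3 :: nat} else if x = 3 then {2} else {}"
  have "parcs (bridge_graph n) `` {x} = ?h ` ?H \<union> ?C" (is "?L = ?R")
  proof (rule set_eqI)
    fix y
    have "y \<in> ?h ` ?H \<longleftrightarrow> y < 8 * n + 6 \<and> even x = even y \<and> half_adj (x div 2) (y div 2)"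
    proof
      assume "y < 8 * n + 6 \<and> even x = even y \<and> half_adj (x div 2) (y div 2)"
      then show "y \<in> ?h ` ?H"
        by (intro image_eqI[of _ _ "y div 2"]) (auto, presburger)
    qed auto
    then show "y \<in> ?L \<longleftrightarrow> y \<in> ?R"
      using x by (auto simp: bridge_graph_def bridge_adj_def doubleton_eq_iff)
  qed
  moreover have "card (?h ` ?H \<union> ?C) = card (?h ` ?H) + card ?C"
  proof (rule card_Un_disjoint)
    show "?h ` ?H \<inter> ?C = {}" by (auto; presburger)
  qed auto
  moreover have "card (?h ` ?H) = card ?H"
    by (intro card_image) (auto simp: inj_on_def)
  moreover have "card ?H = (if x div 2 = 1 then 4 * n else 4 * n + 1)"
    using x by (intro card_half_neighbours) simp
  moreover have "x div 2 = 1 \<longleftrightarrow> x = 2 \<or> x = 3" by presburger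
  ultimately show "out_degree (with_proj (bridge_graph n)) x = 4 * n + 1"
    by (auto simp: out_degree_with_proj)
qed

lemma connected_bridge_graph:
  assumes "n > 0"
  shows "Digraph_Component.connected (with_proj (bridge_graph n))"
proof -
  interpret pair_graph "bridge_graph n" by (rule pair_graph_bridge_graph)
  have adj: "x \<rightarrow>\<^sup>*\<^bsub>with_proj (bridge_graph n)\<^esub> y"
    if "x < 8 * n + 6" "y < 8 * n + 6" "bridge_adj x y" for x y
    using that by (intro reachable_adjI) (simp add: bridge_graph_def)
  have centre: "x \<rightarrow>\<^sup>*\<^bsub>with_proj (bridge_graph n)\<^esub> (2 + x mod 2)" if x: "x < 8 * n + 6" for x
  proof -
    have near: "x \<rightarrow>\<^sup>*\<^bsub>with_proj (bridge_graph n)\<^esub> (2 + x mod 2)"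
      if "x < 8 * n + 6" "x \<ge> 6" for x
      using that by (intro adj) (auto simp: bridge_adj_def half_adj_def doubleton_eq_iff)
    consider "x \<ge> 6" | "x \<in> {2, 3}" | "x \<in> {0, 1, 4, 5}"
      by force
    then show ?thesis
    proof cases
      case 1
      then show ?thesis using near x by simp
    next
      case 2
      then have "2 + x mod 2 = x" by auto
      moreover have "x \<in> pverts (bridge_graph n)" using x by (simp add: bridge_graph_def)
      ultimately show ?thesis by simp
    next
      case 3
      have "x \<rightarrow>\<^sup>*\<^bsub>with_proj (bridge_graph n)\<^esub> (6 + x mod 2)"
        using 3 assms by (intro adj) (auto simp: bridge_adj_def half_adj_def doubleton_eq_iff)
      also have "(6 + x mod 2) \<rightarrow>\<^sup>*\<^bsub>with_proj (bridge_graph n)\<^esub> (2 + x mod 2)"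
      proof -
        have "(6 + x mod 2) mod 2 = x mod 2" "6 + x mod 2 < 8 * n + 6"
          using assms by presburger+
        then show ?thesis using near[of "6 + x mod 2"] by simp
      qed
      finally show ?thesis .
    qed
  qed
  have to2: "x \<rightarrow>\<^sup>*\<^bsub>with_proj (bridge_graph n)\<^esub> 2" if x: "x < 8 * n + 6" for x
  proof (cases "even x")
    case True
    then show ?thesis using centre[OF x] by simp
  next
    case False
    then have "x \<rightarrow>\<^sup>*\<^bsub>with_proj (bridge_graph n)\<^esub> 3"
      using centre[OF x] by (simp add: odd_iff_mod_2_eq_one)
    also have "3 \<rightarrow>\<^sup>*\<^bsub>with_proj (bridge_graph n)\<^esub> 2"
      using assms by (intro adj) (auto simp: bridge_adj_def)
    finally show ?thesis .
  qed
  have "u \<rightarrow>\<^sup>*\<^bsub>with_proj (bridge_graph n)\<^esub> v"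
    if "u < 8 * n + 6" "v < 8 * n + 6" for u v
    using to2[OF that(1)] symmetric_reachable'[OF to2[OF that(2)]] by (rule reachable_trans)
  then have "u \<rightarrow>\<^sup>*\<^bsub>with_proj (mk_symmetric (with_proj (bridge_graph n)))\<^esub> v"
    if "u < 8 * n + 6" "v < 8 * n + 6" for u v
    using that by (simp add: reachable_mk_symmetric_eq[OF pair_sym_arcs])
  then show ?thesis
    by (intro connectedI) (auto simp: bridge_graph_def lessThan_empty_iff)
qed

lemma rna_number_bridge_graph:
  assumes "n > 0"
  shows "rna_number (bridge_graph n) = 1"
proof -
  interpret pair_graph "bridge_graph n" by (rule pair_graph_bridge_graph)
  have "bij_betw Suc (pverts (bridge_graph n)) {1..card (pverts (bridge_graph n))}"
    by (simp add: bridge_graph_def bij_betw_def image_Suc_lessThan)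
  then have "rna_number (bridge_graph n) \<le> card (odd_even_edges (bridge_graph n) Suc)"
    by (rule rna_number_le)
  also have "odd_even_edges (bridge_graph n) Suc \<subseteq> {{2, 3}}"
    by (auto simp: odd_even_edges_def bridge_graph_def bridge_adj_def)
  then have "card (odd_even_edges (bridge_graph n) Suc) \<le> card {{2, 3::nat}}"
    by (intro card_mono) auto
  finally have "rna_number (bridge_graph n) \<le> 1" by simp
  moreover have "rna_number (bridge_graph n) \<noteq> 0"
  proof -
    obtain f where f: "bij_betw f (pverts (bridge_graph n)) {1..card (pverts (bridge_graph n))}"
      "rna_number (bridge_graph n) = card (odd_even_edges (bridge_graph n) f)"
      using rna_number_attained[OF pair_finite_verts] .
    have "odd_even_edges (bridge_graph n) f \<noteq> {}"
      using connected_bridge_graph[OF assms] _ f(1)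
      by (rule odd_even_edges_nonempty) (simp add: bridge_graph_def)
    moreover have "finite (odd_even_edges (bridge_graph n) f)"
      by (rule finite_subset[of _ "(\<lambda>(u, v). {u, v}) ` parcs (bridge_graph n)"])
        (use pair_finite_arcs in \<open>auto simp: odd_even_edges_def\<close>)
    ultimately show ?thesis using f(2) by simp
  qed
  ultimately show ?thesis by simp
qed

theorem theorem6p10:
  fixes n :: nat
  assumes "n > 0"
  shows "(\<exists>G :: nat pair_pre_digraph. pair_graph G \<and> Digraph_Component.connected (with_proj G)
            \<and> regular_graph (4 * n + 1) G \<and> rna_number G = 1 \<and> card (pverts G) = 8 * n + 6)
       \<and> (\<forall>G :: 'a pair_pre_digraph. pair_graph G \<and> Digraph_Component.connected (with_proj G)
            \<and> regular_graph (4 * n + 1) G \<and> rna_number G = 1 \<longrightarrow> 8 * n + 6 \<le> card (pverts G))"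
proof (intro conjI allI impI)
  have "card (pverts (bridge_graph n)) = 8 * n + 6" by (simp add: bridge_graph_def)
  then show "\<exists>G :: nat pair_pre_digraph. pair_graph G \<and> Digraph_Component.connected (with_proj G)
            \<and> regular_graph (4 * n + 1) G \<and> rna_number G = 1 \<and> card (pverts G) = 8 * n + 6"
    using pair_graph_bridge_graph connected_bridge_graph[OF assms] regular_bridge_graph
      rna_number_bridge_graph[OF assms] by blast
next
  fix G :: "'a pair_pre_digraph"
  assume G: "pair_graph G \<and> Digraph_Component.connected (with_proj G)
            \<and> regular_graph (4 * n + 1) G \<and> rna_number G = 1"
  then show "8 * n + 6 \<le> card (pverts G)"
    using pair_graph.card_verts_rna_number_one[of G "4 * n + 1"] assms by simp
qed

end
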